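(* For every $n\ge 1$, $L(2,n) = L(1,n)$.
   Context: A coloring game is given by a finite set $V$ of $n$ players and a symmetric weight function $w$ with $w_{uv}=w_{vu}\in \mathbb{Z}\cup\{-\infty\}$ for distinct $u,v$. A state is a partition $P$ of $V$; $X(u)$ is the group of $u$ and $f_u(P)=\sum_{v\in X(u)\setminus\{u\}} w_{uv}$. A $k$-deviation from $P$ is a set $S$ of at most $k$ players and a (possibly empty) group $X$ of $P$ such that moving all players of $S$ into $X$ strictly increases the utility of every member of $S$. Starting from the all-singletons partition, $k$-deviations are applied successively. The game is uniform if all weights lie in $\{-\infty,1\}$. $L(k,n)$ is the maximum length of a sequence of successive $k$-deviations (from the all-singletons partition) over all uniform games with at most $n$ players. *)

theory Defs
  imports "HOL-Library.Extended_Real" "HOL-Library.Disjoint_Sets"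
begin

definition coloring_game :: "'a set \<Rightarrow> ('a \<Rightarrow> 'a \<Rightarrow> ereal) \<Rightarrow> bool" where
  "coloring_game V w \<longleftrightarrow> finite V \<and>
     (\<forall>u\<in>V. \<forall>v\<in>V. u \<noteq> v \<longrightarrow> w u v = w v u \<and> (w u v = -\<infinity> \<or> (\<exists>z::int. w u v = ereal (of_int z))))"

definition uniform_game :: "'a set \<Rightarrow> ('a \<Rightarrow> 'a \<Rightarrow> ereal) \<Rightarrow> bool" where
  "uniform_game V w \<longleftrightarrow> coloring_game V w \<and> (\<forall>u\<in>V. \<forall>v\<in>V. u \<noteq> v \<longrightarrow> w u v \<in> {-\<infinity>, 1})"

definition group :: "'a set set \<Rightarrow> 'a \<Rightarrow> 'a set" where
  "group P u = (THE C. C \<in> P \<and> u \<in> C)"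

definition utility :: "('a \<Rightarrow> 'a \<Rightarrow> ereal) \<Rightarrow> 'a set set \<Rightarrow> 'a \<Rightarrow> ereal" where
  "utility w P u = (\<Sum>v\<in>group P u - {u}. w u v)"

text \<open>The partition obtained from \<open>P\<close> by moving all players of \<open>S\<close> into the group \<open>X\<close>; taking
  \<open>X = {}\<close> opens a new group, and groups that become empty are dropped.\<close>

definition move :: "'a set set \<Rightarrow> 'a set \<Rightarrow> 'a set \<Rightarrow> 'a set set" where
  "move P S X = insert (X \<union> S) ((\<lambda>C. C - S) ` (P - {X})) - {{}}"

text \<open>\<open>S\<close> is required to be nonempty: an empty set of players would vacuously qualify, and the
  lengths of deviation sequences would be unbounded.\<close>

definition deviation :: "'a set \<Rightarrow> ('a \<Rightarrow> 'a \<Rightarrow> ereal) \<Rightarrow> nat \<Rightarrow> 'a set set \<Rightarrow> 'a set set \<Rightarrow> bool" where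
  "deviation V w k P Q \<longleftrightarrow>
     (\<exists>S X. S \<subseteq> V \<and> S \<noteq> {} \<and> card S \<le> k \<and> X \<in> insert {} P \<and> Q = move P S X \<and>
        (\<forall>u\<in>S. utility w P u < utility w Q u))"

definition singletons :: "'a set \<Rightarrow> 'a set set" where
  "singletons V = (\<lambda>v. {v}) ` V"

text \<open>Every finite game is isomorphic to one whose players are natural numbers, so it suffices to
  range over these.\<close>

definition deviation_lengths :: "nat \<Rightarrow> nat \<Rightarrow> nat set" where
  "deviation_lengths k n =
     {m. \<exists>(V :: nat set) w P. uniform_game V w \<and> card V \<le> n \<and>
           (deviation V w k ^^ m) (singletons V) P}"

definition L :: "nat \<Rightarrow> nat \<Rightarrow> nat" where
  "L k n = Max (deviation_lengths k n)"

text \<open>The remaining lemmas show that \<open>L\<close> is well defined: \<open>Max\<close> is taken over a finite nonempty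
  set. The potential \<open>\<Sum>C\<in>P. (n + 1) ^ card C\<close> increases with every deviation.\<close>

lemma group_eq:
  assumes "partition_on V P" "C \<in> P" "u \<in> C"
  shows "group P u = C"
  unfolding group_def
proof (rule the_equality)
  show "C \<in> P \<and> u \<in> C" using assms by simp
  show "D = C" if "D \<in> P \<and> u \<in> D" for D
    using that assms by (auto simp: partition_on_def disjoint_def)
qed

lemma card_partition_le:
  assumes "finite V" "partition_on V P"
  shows "finite P" "card P \<le> card V"
proof -
  have sub: "P \<subseteq> group P ` V"
  proof
    fix C assume C: "C \<in> P"
    then obtain u where u: "u \<in> C" using assms(2) by (metis partition_onD3 ex_in_conv)
    then have "u \<in> V" using C assms(2) by (auto simp: partition_on_def)
    then show "C \<in> group P ` V" using group_eq[OF assms(2) C u] by auto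
  qed
  then show "finite P" using assms(1) finite_subset by blast
  show "card P \<le> card V"
    using card_mono[OF _ sub] card_image_le[OF assms(1), of "group P"] assms(1) by fastforce
qed

lemma partition_on_move:
  assumes "partition_on V P" "S \<subseteq> V" "X \<in> insert {} P"
  shows "partition_on V (move P S X)"
proof (rule partition_onI)
  have V: "\<Union>P = V" and disj: "\<And>C D. C \<in> P \<Longrightarrow> D \<in> P \<Longrightarrow> C \<noteq> D \<Longrightarrow> C \<inter> D = {}"
    using assms(1) by (auto simp: partition_on_def disjoint_def)
  show "\<Union>(move P S X) = V"
  proof -
    have "\<Union>(move P S X) = X \<union> S \<union> (\<Union>(P - {X}) - S)"
      unfolding move_def by auto
    also have "\<dots> = X \<union> \<Union>(P - {X}) \<union> S" by blast
    also have "X \<union> \<Union>(P - {X}) = V" using V assms(3) by auto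
    finally show ?thesis using assms(2) by blast
  qed
  show "{} \<notin> move P S X"
    by (auto simp: move_def)
  show "disjnt p q" if "p \<in> move P S X" "q \<in> move P S X" "p \<noteq> q" for p q
  proof -
    have *: "disjnt (X \<union> S) (C - S)" if "C \<in> P - {X}" for C
      using that disj[of C X] assms(3) by (auto simp: disjnt_def)
    have **: "disjnt (C - S) (D - S)" if "C \<in> P" "D \<in> P" "C \<noteq> D" for C D
      using disj[OF that] by (auto simp: disjnt_def)
    have "p = X \<union> S \<or> (\<exists>C\<in>P - {X}. p = C - S)" "q = X \<union> S \<or> (\<exists>D\<in>P - {X}. q = D - S)"
      using that(1,2) by (auto simp: move_def)
    then consider "p = X \<union> S" "q = X \<union> S"
      | C where "C \<in> P - {X}" "p = C - S" "q = X \<union> S"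
      | D where "D \<in> P - {X}" "q = D - S" "p = X \<union> S"
      | C D where "C \<in> P" "D \<in> P" "p = C - S" "q = D - S"
      by blast
    then show ?thesis
    proof cases
      case 1 then show ?thesis using \<open>p \<noteq> q\<close> by simp
    next
      case 2 then show ?thesis using *[of C] by (simp add: disjnt_sym)
    next
      case 3 then show ?thesis using *[of D] by simp
    next
      case 4
      then have "C \<noteq> D" using \<open>p \<noteq> q\<close> by blast
      then show ?thesis using **[of C D] 4 by simp
    qed
  qed
qed

definition compatible :: "('a \<Rightarrow> 'a \<Rightarrow> ereal) \<Rightarrow> 'a set set \<Rightarrow> bool" where
  "compatible w P \<longleftrightarrow> (\<forall>C\<in>P. \<forall>u\<in>C. \<forall>v\<in>C. u \<noteq> v \<longrightarrow> w u v = 1)"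

lemma sum_weights_not_MInf:
  fixes f :: "'a \<Rightarrow> ereal"
  assumes "finite A" "\<And>v. v \<in> A \<Longrightarrow> f v \<in> {-\<infinity>, 1}" "sum f A \<noteq> -\<infinity>" "v \<in> A"
  shows "f v = 1"
proof (rule ccontr)
  assume "f v \<noteq> 1"
  then have fv: "f v = -\<infinity>" using assms by auto
  have "sum f (A - {v}) \<le> (\<Sum>v\<in>A - {v}. ereal 1)"
    by (rule sum_mono) (use assms(2) in fastforce)
  also have "\<dots> < \<infinity>" by (simp del: ereal_eq_1 add: sum_ereal)
  finally have "sum f (A - {v}) \<noteq> \<infinity>" by auto
  then have "sum f A = -\<infinity>"
    using sum.remove[OF assms(1,4), of f] fv by simp
  then show False using assms(3) by simp
qed

lemma utility_compatible:
  assumes "finite V" "partition_on V P" "compatible w P" "C \<in> P" "u \<in> C"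
  shows "utility w P u = ereal (real (card C - 1))"
proof -
  have "finite C" using assms by (auto simp: partition_on_def intro: finite_subset)
  moreover have "utility w P u = (\<Sum>v\<in>C - {u}. ereal 1)"
    unfolding utility_def group_eq[OF assms(2,4,5)]
    by (rule sum.cong) (use assms(3,4,5) in \<open>auto simp: compatible_def\<close>)
  ultimately show ?thesis using assms(5) by (simp del: ereal_eq_1 add: sum_ereal)
qed

lemma deviation_step:
  assumes game: "uniform_game V w" and n: "card V \<le> n"
    and P: "partition_on V P" "compatible w P" and dev: "deviation V w k P Q"
  shows "partition_on V Q" "compatible w Q"
    and "(\<Sum>C\<in>P. (n + 1) ^ card C) < (\<Sum>C\<in>Q. (n + 1) ^ card C)"
proof -
  from dev obtain S X where S: "S \<subseteq> V" "S \<noteq> {}" and X: "X \<in> insert {} P" and Q: "Q = move P S X"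
    and imp: "\<And>u. u \<in> S \<Longrightarrow> utility w P u < utility w Q u"
    unfolding deviation_def by blast
  have fin: "finite V" and sym: "\<And>u v. u \<in> V \<Longrightarrow> v \<in> V \<Longrightarrow> u \<noteq> v \<Longrightarrow> w u v = w v u"
    and unif: "\<And>u v. u \<in> V \<Longrightarrow> v \<in> V \<Longrightarrow> u \<noteq> v \<Longrightarrow> w u v \<in> {-\<infinity>, 1}"
    using game by (auto simp: uniform_game_def coloring_game_def)
  show pQ: "partition_on V Q" using partition_on_move[OF P(1) S(1) X] Q by simp
  define Y where "Y = X \<union> S"
  have YQ: "Y \<in> Q" using S(2) by (auto simp: Y_def Q move_def)
  have YV: "Y \<subseteq> V" using pQ YQ by (auto simp: partition_on_def)
  have finY: "finite Y" using YV fin finite_subset by blast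
  have w1: "w u v = 1" if u: "u \<in> S" and v: "v \<in> Y" "u \<noteq> v" for u v
  proof -
    have uY: "u \<in> Y" using u by (simp add: Y_def)
    have "utility w Q u \<noteq> -\<infinity>" using imp[OF u] by auto
    then have "(\<Sum>v\<in>Y - {u}. w u v) \<noteq> -\<infinity>"
      unfolding utility_def group_eq[OF pQ YQ uY] .
    then show ?thesis
      by (rule sum_weights_not_MInf[rotated 2]) (use finY unif YV uY v in auto)
  qed
  have wY: "w u v = 1" if uv: "u \<in> Y" "v \<in> Y" "u \<noteq> v" for u v
  proof -
    consider "u \<in> S" | "v \<in> S" | "u \<in> X" "v \<in> X" using uv by (auto simp: Y_def)
    then show ?thesis
    proof cases
      case 1 then show ?thesis using w1 uv by auto
    next
      case 2 then show ?thesis using w1[of v u] sym[of u v] uv YV by auto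
    next
      case 3 then show ?thesis using P(2) X uv by (auto simp: compatible_def)
    qed
  qed
  show cQ: "compatible w Q"
    unfolding compatible_def
  proof (intro ballI impI)
    fix C u v assume C: "C \<in> Q" and uv: "u \<in> C" "v \<in> C" "u \<noteq> v"
    have "C = Y \<or> (\<exists>D\<in>P. C = D - S)" using C by (auto simp: Q move_def Y_def)
    then show "w u v = 1" using wY uv P(2) by (auto simp: compatible_def)
  qed
  have less: "card C < card Y" if C: "C \<in> P" "u \<in> C" "u \<in> S" for C u
  proof -
    have uY: "u \<in> Y" using C by (simp add: Y_def)
    have "real (card C - 1) < real (card Y - 1)"
      using imp[OF C(3)] utility_compatible[OF fin P C(1,2)] utility_compatible[OF fin pQ cQ YQ uY]
      by simp
    then show ?thesis by simp
  qed
  have lessX: "card X < card Y" if "X \<in> P"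
  proof -
    have "\<not> S \<subseteq> X"
    proof
      assume "S \<subseteq> X"
      then have "Y = X" by (auto simp: Y_def)
      moreover obtain u where "u \<in> S" using S by auto
      ultimately show False using less[of X u] that \<open>S \<subseteq> X\<close> by auto
    qed
    then have "X \<subset> Y" by (auto simp: Y_def)
    then show ?thesis using finY psubset_card_mono by blast
  qed
  define U where "U = {C \<in> P. C \<inter> S = {} \<and> C \<noteq> X}"
  have finP: "finite P" "card P \<le> card V" using card_partition_le[OF fin P(1)] by auto
  have finQ: "finite Q" using card_partition_le[OF fin pQ] by auto
  have UQ: "U \<subseteq> Q"
  proof
    fix C assume C: "C \<in> U"
    then have "C \<noteq> {}" "C = C - S" using P(1) by (auto simp: U_def partition_on_def)
    then show "C \<in> Q" using C by (auto simp: Q move_def U_def)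
  qed
  have YU: "Y \<notin> U" using S(2) by (auto simp: Y_def U_def)
  have finU: "finite U" using finP by (auto simp: U_def)
  have pos: "card Y > 0" using finY S(2) by (auto simp: Y_def card_gt_0_iff)
  have le: "(n + 1) ^ card C \<le> (n + 1) ^ (card Y - 1)" if "C \<in> P - U" for C
  proof -
    have "card C < card Y" using that less lessX by (auto simp: U_def)
    then show ?thesis by (intro power_increasing) auto
  qed
  have "(\<Sum>C\<in>P. (n + 1) ^ card C) = (\<Sum>C\<in>P - U. (n + 1) ^ card C) + (\<Sum>C\<in>U. (n + 1) ^ card C)"
    using finP(1) by (intro sum.subset_diff) (auto simp: U_def)
  also have "(\<Sum>C\<in>P - U. (n + 1) ^ card C) \<le> card (P - U) * (n + 1) ^ (card Y - 1)"
    using sum_bounded_above[of "P - U" "\<lambda>C. (n + 1) ^ card C", OF le] by simp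
  also have "\<dots> \<le> n * (n + 1) ^ (card Y - 1)"
  proof -
    have "card (P - U) \<le> card P" using finP by (intro card_mono) auto
    then have "card (P - U) \<le> n" using finP(2) n by linarith
    then show ?thesis by (rule mult_right_mono) simp
  qed
  also have "\<dots> < (n + 1) * (n + 1) ^ (card Y - 1)" by simp
  also have "\<dots> = (n + 1) ^ card Y" using pos by (cases "card Y") auto
  also have "(n + 1) ^ card Y + (\<Sum>C\<in>U. (n + 1) ^ card C) = (\<Sum>C\<in>insert Y U. (n + 1) ^ card C)"
    using YU finU by simp
  also have "\<dots> \<le> (\<Sum>C\<in>Q. (n + 1) ^ card C)"
    using finQ YQ UQ by (intro sum_mono2) auto
  finally show "(\<Sum>C\<in>P. (n + 1) ^ card C) < (\<Sum>C\<in>Q. (n + 1) ^ card C)" by simp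
qed

lemma deviation_sequence:
  assumes "uniform_game V w" "card V \<le> n" "(deviation V w k ^^ m) (singletons V) P"
  shows "partition_on V P \<and> compatible w P \<and> m \<le> (\<Sum>C\<in>P. (n + 1) ^ card C)"
  using assms(3)
proof (induction m arbitrary: P)
  case 0
  then have "P = singletons V" by simp
  then show ?case
    by (auto simp: singletons_def compatible_def partition_on_def disjoint_def)
next
  case (Suc m)
  then obtain P' where P': "(deviation V w k ^^ m) (singletons V) P'" "deviation V w k P' P"
    by auto
  have IH: "partition_on V P'" "compatible w P'" "m \<le> (\<Sum>C\<in>P'. (n + 1) ^ card C)"
    using Suc.IH[OF P'(1)] by auto
  note step = deviation_step[OF assms(1,2) IH(1,2) P'(2)]
  have "Suc m \<le> (\<Sum>C\<in>P. (n + 1) ^ card C)"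
    using IH(3) step(3) by linarith
  then show ?case using step(1,2) by blast
qed

lemma finite_deviation_lengths: "finite (deviation_lengths k n)"
proof (rule finite_subset)
  show "deviation_lengths k n \<subseteq> {..n * (n + 1) ^ n}"
  proof
    fix m assume "m \<in> deviation_lengths k n"
    then obtain V :: "nat set" and w P where V: "uniform_game V w" "card V \<le> n"
      and seq: "(deviation V w k ^^ m) (singletons V) P"
      by (auto simp: deviation_lengths_def)
    have fin: "finite V" using V(1) by (simp add: uniform_game_def coloring_game_def)
    have P: "partition_on V P" and m: "m \<le> (\<Sum>C\<in>P. (n + 1) ^ card C)"
      using deviation_sequence[OF V seq] by auto
    have le: "(n + 1) ^ card C \<le> (n + 1) ^ n" if "C \<in> P" for C
    proof -
      have "C \<subseteq> V" using that P by (auto simp: partition_on_def)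
      then have "card C \<le> n" using card_mono[OF fin, of C] V(2) by linarith
      then show ?thesis by (intro power_increasing) auto
    qed
    have "(\<Sum>C\<in>P. (n + 1) ^ card C) \<le> card P * (n + 1) ^ n"
      using sum_bounded_above[of P "\<lambda>C. (n + 1) ^ card C", OF le] by simp
    also have "\<dots> \<le> n * (n + 1) ^ n"
    proof (rule mult_right_mono)
      show "card P \<le> n" using card_partition_le(2)[OF fin P] V(2) by linarith
    qed simp
    finally have "m \<le> n * (n + 1) ^ n" using m by linarith
    then show "m \<in> {..n * (n + 1) ^ n}" by blast
  qed
qed (rule finite_atMost)

lemma deviation_lengths_nonempty: "0 \<in> deviation_lengths k n"
proof -
  have "uniform_game {} (\<lambda>_ _. 1 :: ereal)"
    by (simp add: uniform_game_def coloring_game_def)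
  then show ?thesis
    unfolding deviation_lengths_def by (auto intro!: exI[of _ "{} :: nat set"])
qed

end

theory Submission
  imports Defs "HOL-Library.Multiset"
begin

text \<open>Up to isomorphism, a state of the uniform game with all weights 1 is the multiset of its
  group sizes, and a 1-deviation takes a unit from a part \<open>a\<close> to another part \<open>b \<ge> a\<close>.
  In any uniform game, a 2-deviation changes the group sizes by one or two such transfers: the moves
  that cannot be split into two 1-deviations leave a group \<open>B\<close> with one player more than the
  target \<open>X\<close>, and then exchanging the roles of \<open>B\<close> and \<open>X\<close> gives a single transfer.\<close>

section \<open>Multisets of group sizes and unit transfers\<close>

definition part :: "nat \<Rightarrow> nat multiset" where
  "part a = (if a = 0 then {#} else {#a#})"

definition sizes :: "'a set set \<Rightarrow> nat multiset" where
  "sizes P = (\<Sum>C\<in>P. part (card C))"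

text \<open>The bound \<open>a \<le> b\<close> is the strict gain of a lone mover, whose utility
  goes from \<open>a - 1\<close> to \<open>b\<close>. It forces \<open>b \<ge> 1\<close>, so no
  transfer opens a new group. A donor of size 1 vanishes because \<open>part 0\<close> is
  empty.\<close>

definition transfer_step :: "nat multiset \<Rightarrow> nat multiset \<Rightarrow> bool" where
  "transfer_step M N \<longleftrightarrow> (\<exists>a b K. 1 \<le> a \<and> a \<le> b \<and>
     M = part a + part b + K \<and> N = part (a - 1) + part (b + 1) + K)"

lemma part_simps [simp]: "part 0 = {#}" "a > 0 \<Longrightarrow> part a = {#a#}"
  by (auto simp: part_def)

lemma transfer_stepI:
  assumes "1 \<le> a" "a \<le> b" "M = part a + part b + K" "N = part (a - 1) + part (b + 1) + K"
  shows "transfer_step M N"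
  using assms unfolding transfer_step_def by blast

section \<open>Group sizes after a move\<close>

lemma sizes_move:
  assumes V: "finite V" and P: "partition_on V P" and S: "S \<noteq> {}"
  shows "sizes (move P S X) = part (card (X \<union> S)) + (\<Sum>C\<in>P - {X}. part (card (C - S)))"
proof -
  have finP: "finite P" using card_partition_le[OF V P] by simp
  have disj: "C \<inter> D = {}" if "C \<in> P" "D \<in> P" "C \<noteq> D" for C D
    using P that by (auto simp: partition_on_def disjoint_def)
  have notin: "X \<union> S \<notin> (\<lambda>C. C - S) ` (P - {X})" using S by auto
  have "sizes (move P S X) = (\<Sum>C\<in>insert (X \<union> S) ((\<lambda>C. C - S) ` (P - {X})). part (card C))"
    unfolding sizes_def move_def using finP by (intro sum.mono_neutral_left) auto
  also have "\<dots> = part (card (X \<union> S)) + (\<Sum>C\<in>(\<lambda>C. C - S) ` (P - {X}). part (card C))"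
    using finP notin by (intro sum.insert) auto
  also have "(\<Sum>C\<in>(\<lambda>C. C - S) ` (P - {X}). part (card C)) = (\<Sum>C\<in>P - {X}. part (card (C - S)))"
  proof (subst sum.reindex_nontrivial)
    \<comment> \<open>Disjoint groups with equal remainders were both emptied, and empty remainders
      contribute nothing. The collapse of images is therefore invisible to the sum.\<close>
    show "part (card (C - S)) = 0"
      if C: "C \<in> P - {X}" and D: "D \<in> P - {X}" and ne: "C \<noteq> D" and eq: "C - S = D - S" for C D
    proof -
      have "C - S = {}" using disj[of C D] C D ne eq by blast
      then show ?thesis by (simp only: card.empty part_simps empty_neutral)
    qed
  qed (use finP in simp_all)
  finally show ?thesis .
qed

lemma sum_part_Diff:
  assumes "finite R" "\<And>C. C \<in> R \<Longrightarrow> C \<inter> S = {}"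
  shows "(\<Sum>C\<in>R. part (card (C - S))) = sizes R"
  unfolding sizes_def by (intro sum.cong) (simp_all add: Diff_triv assms)

lemma sizes_remove:
  assumes "finite P" "C \<in> P"
  shows "sizes P = part (card C) + sizes (P - {C})"
  using assms unfolding sizes_def by (rule sum.remove)

lemma sizes_remove_target:
  assumes "finite P" "X \<in> insert {} P"
  shows "sizes P = part (card X) + sizes (P - {X})"
proof (cases "X \<in> P")
  case True then show ?thesis using sizes_remove assms by blast
next
  case False then show ?thesis using assms by simp
qed

text \<open>A deviating set may contain players who already sit in the target and gain from the
  newcomers. Discarding them leaves only the players who change groups.\<close>

lemma move_Diff_target:
  assumes "partition_on V P" "X \<in> insert {} P"
  shows "move P S X = move P (S - X) X"
proof -
  have "C - S = C - (S - X)" if "C \<in> P - {X}" for C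
  proof -
    have "C \<inter> X = {}" using assms that by (auto simp: partition_on_def disjoint_def)
    then show ?thesis by blast
  qed
  then have "(\<lambda>C. C - S) ` (P - {X}) = (\<lambda>C. C - (S - X)) ` (P - {X})"
    by (rule image_cong[OF refl])
  then show ?thesis unfolding move_def by (simp add: Un_Diff_cancel)
qed

section \<open>Two units moved at once\<close>

lemma transfer_two_same:
  assumes "2 \<le> a" "a \<le> x + 1"
    and M: "M = part a + part x + K" "N = part (a - 2) + part (x + 2) + K"
  shows "transfer_step\<^sup>+\<^sup>+ M N"
proof (cases "a = x + 1")
  case True
  \<comment> \<open>Here a transfer from \<open>a\<close> to \<open>x\<close> is not allowed. But
    the result has parts \<open>x - 1\<close> and \<open>x + 2 = a + 1\<close>, which is what one
    unit given by \<open>x\<close> to \<open>a\<close> produces.\<close>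
  have "transfer_step M N"
    by (rule transfer_stepI[of x a _ K]) (use assms True in \<open>auto simp: add_ac\<close>)
  then show ?thesis by blast
next
  case False
  have "transfer_step M (part (a - 1) + part (x + 1) + K)"
    by (rule transfer_stepI[of a x _ K]) (use assms False in auto)
  moreover have "transfer_step (part (a - 1) + part (x + 1) + K) N"
    by (rule transfer_stepI[of "a - 1" "x + 1" _ K]) (use assms False in \<open>auto simp: numeral_2_eq_2\<close>)
  ultimately show ?thesis by (meson tranclp.simps)
qed

lemma transfer_two_distinct:
  assumes "1 \<le> a" "1 \<le> b" "a \<le> x + 1" "b \<le> x + 1"
    and "M = part a + part b + part x + K" "N = part (a - 1) + part (b - 1) + part (x + 2) + K"
  shows "transfer_step\<^sup>+\<^sup>+ M N"
  using assms
proof (induction a b rule: linorder_wlog)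
  case (le a b)
  show ?case
  proof (cases "b = x + 1")
    case True
    \<comment> \<open>Now \<open>b - 1 = x\<close> and \<open>x + 2 = b + 1\<close>: the sizes look
      as if \<open>x\<close> were untouched and \<open>a\<close> gave one unit to \<open>b\<close>.
      This covers two singletons founding a new group, where \<open>x = 0\<close>.\<close>
    have "transfer_step M N"
      by (rule transfer_stepI[of a b _ "part x + K"]) (use le True in \<open>auto simp: add_ac\<close>)
    then show ?thesis by blast
  next
    case False
    \<comment> \<open>Here \<open>a \<le> b \<le> x\<close>, so the two units can be moved one after
      the other.\<close>
    have "transfer_step M (part (a - 1) + part b + part (x + 1) + K)"
      by (rule transfer_stepI[of a x _ "part b + K"]) (use le False in \<open>auto simp: add_ac\<close>)
    moreover have "transfer_step (part (a - 1) + part b + part (x + 1) + K) N"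
      by (rule transfer_stepI[of b "x + 1" _ "part (a - 1) + K"])
        (use le False in \<open>auto simp: add_ac\<close>)
    ultimately show ?thesis by (meson tranclp.simps)
  qed
next
  case (sym a b)
  then show ?case by (simp add: add_ac)
qed

text \<open>Compatibility turns each strict gain into an inequality between group sizes, so
  \<open>w\<close> drops out. The rest is a case split on how many players change groups and whether
  they leave the same group.\<close>

lemma deviation_transfer:
  assumes game: "uniform_game V w" and P: "partition_on V P" "compatible w P"
    and dev: "deviation V w 2 P Q"
  shows "transfer_step\<^sup>+\<^sup>+ (sizes P) (sizes Q)"
proof -
  from dev obtain S X where S: "S \<subseteq> V" "S \<noteq> {}" "card S \<le> 2" and X: "X \<in> insert {} P"
    and Q: "Q = move P S X" and imp: "\<And>u. u \<in> S \<Longrightarrow> utility w P u < utility w Q u"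
    unfolding deviation_def by blast
  have finV: "finite V" using game by (simp add: uniform_game_def coloring_game_def)
  have pQ: "partition_on V Q" and cQ: "compatible w Q"
    using deviation_step[OF game order_refl P dev] by auto
  have finP: "finite P" using card_partition_le[OF finV P(1)] by simp
  have disj: "C \<inter> D = {}" if "C \<in> P" "D \<in> P" "C \<noteq> D" for C D
    using P(1) that by (auto simp: partition_on_def disjoint_def)
  have disjX: "C \<inter> X = {}" if "C \<in> P - {X}" for C using X disj that by auto
  have finC: "finite C" if "C \<in> P" for C
    using that P(1) finV by (auto simp: partition_on_def intro: finite_subset)
  have finX: "finite X" using X finC by auto
  have YQ: "X \<union> S \<in> Q" using S(2) by (auto simp: Q move_def)
  have less: "card C < card (X \<union> S)" if C: "C \<in> P" "u \<in> C" "u \<in> S" for C u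
  proof -
    have uY: "u \<in> X \<union> S" using C by simp
    have "real (card C - 1) < real (card (X \<union> S) - 1)"
      using imp[OF C(3)] utility_compatible[OF finV P C(1,2)]
        utility_compatible[OF finV pQ cQ YQ uY] by simp
    then show ?thesis by simp
  qed
  \<comment> \<open>The players who really move. There is at least one, since otherwise the group of
    every deviator would be unchanged.\<close>
  define T where "T = S - X"
  have XT: "X \<union> S = X \<union> T" "X \<inter> T = {}" and TS: "T \<subseteq> S" by (auto simp: T_def)
  have finT: "finite T" using TS S(1) finV by (meson finite_subset)
  have Tne: "T \<noteq> {}"
  proof
    assume "T = {}"
    then have "X \<union> S = X" "S \<subseteq> X" by (auto simp: T_def)
    moreover obtain u where "u \<in> S" using S(2) by auto
    ultimately show False using less[of X u] X by auto
  qed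
  have "card T \<le> card S" using TS S(1) finV by (meson card_mono finite_subset)
  then have cT: "card T \<le> 2" using S(3) by simp
  have cXT: "card (X \<union> T) = card X + card T"
    using finX finT XT(2) by (rule card_Un_disjoint)
  have sQ: "sizes Q = part (card X + card T) + (\<Sum>C\<in>P - {X}. part (card (C - T)))"
    using sizes_move[OF finV P(1) Tne, of X] move_Diff_target[OF P(1) X, of S] cXT
    by (simp add: Q T_def)
  have sP: "sizes P = part (card X) + sizes (P - {X})"
    using finP X by (rule sizes_remove_target)
  have ex: "\<exists>C\<in>P - {X}. u \<in> C" if "u \<in> T" for u
    using that S(1) P(1) by (auto simp: partition_on_def T_def)
  \<comment> \<open>A single mover leaves a group of size at most \<open>card X\<close>. With two
    movers the limit is \<open>card X + 1\<close>, and this extra unit is the source of the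
    exceptional cases above.\<close>
  have bound: "1 \<le> card C \<and> card C < card X + card T" if "C \<in> P - {X}" "u \<in> C" "u \<in> T" for C u
    using less[of C u] that TS finC[of C] cXT XT(1) by (auto simp: Suc_le_eq card_gt_0_iff)
  consider u where "T = {u}" | u v where "T = {u, v}" "u \<noteq> v"
  proof -
    have "card T = 1 \<or> card T = 2" using cT Tne finT card_gt_0_iff[of T] by linarith
    then show thesis using that by (auto simp: card_1_singleton_iff card_2_iff)
  qed
  then show ?thesis
  proof cases
    case 1
    then obtain A where A: "A \<in> P - {X}" "u \<in> A" using ex by blast
    have "(\<Sum>C\<in>P - {X}. part (card (C - T))) = part (card (A - T)) + sizes (P - {X} - {A})"
      using finP A 1 disj[of A] by (subst sum.remove[of _ A]) (auto intro!: sum_part_Diff)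
    moreover have "card (A - T) = card A - 1" using 1 A finC[of A] by simp
    ultimately have Q': "sizes Q = part (card A - 1) + part (card X + 1) + sizes (P - {X} - {A})"
      using sQ 1 by (simp add: add_ac)
    have "sizes P = part (card A) + part (card X) + sizes (P - {X} - {A})"
      using sP sizes_remove[of "P - {X}" A] finP A by (simp add: add_ac)
    then have "transfer_step (sizes P) (sizes Q)"
      by (rule transfer_stepI[rotated 2]) (use bound[OF A] 1 Q' in auto)
    then show ?thesis by blast
  next
    case 2
    then obtain A B where A: "A \<in> P - {X}" "u \<in> A" and B: "B \<in> P - {X}" "v \<in> B"
      using ex by blast
    have T2: "card T = 2" using 2 by simp
    show ?thesis
    proof (cases "A = B")
      case True
      have "(\<Sum>C\<in>P - {X}. part (card (C - T))) = part (card (A - T)) + sizes (P - {X} - {A})"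
        using finP A B 2 True disj[of A] by (subst sum.remove[of _ A]) (auto intro!: sum_part_Diff)
      moreover have TA: "T \<subseteq> A" using 2 A B True by auto
      then have "card (A - T) = card A - 2" using T2 card_Diff_subset[OF finT, of A] by simp
      ultimately have Q': "sizes Q = part (card A - 2) + part (card X + 2) + sizes (P - {X} - {A})"
        using sQ T2 by (simp add: add_ac)
      have "2 \<le> card A" using card_mono[OF _ TA] finC A T2 by auto
      moreover have "sizes P = part (card A) + part (card X) + sizes (P - {X} - {A})"
        using sP sizes_remove[of "P - {X}" A] finP A by (simp add: add_ac)
      ultimately show ?thesis
        using bound[OF A] 2 T2 Q' by (intro transfer_two_same[of "card A" "card X"]) auto
    next
      case False
      let ?R = "P - {X} - {A} - {B}"
      have AB: "A \<inter> B = {}" using disj A B False by auto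
      have "(\<Sum>C\<in>P - {X}. part (card (C - T))) =
          part (card (A - T)) + (\<Sum>C\<in>P - {X} - {A}. part (card (C - T)))"
        using finP A by (intro sum.remove) auto
      also have "(\<Sum>C\<in>P - {X} - {A}. part (card (C - T))) =
          part (card (B - T)) + (\<Sum>C\<in>?R. part (card (C - T)))"
        using finP B False by (intro sum.remove) auto
      also have "(\<Sum>C\<in>?R. part (card (C - T))) = sizes ?R"
        using finP A B 2 disj[of A] disj[of B] by (intro sum_part_Diff) auto
      finally have "(\<Sum>C\<in>P - {X}. part (card (C - T))) =
          part (card (A - T)) + (part (card (B - T)) + sizes ?R)" .
      moreover have "A - T = A - {u}" "B - T = B - {v}" using 2 A B AB by auto
      then have "card (A - T) = card A - 1" "card (B - T) = card B - 1"
        using A B finC by auto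
      ultimately have Q': "sizes Q =
          part (card A - 1) + part (card B - 1) + part (card X + 2) + sizes ?R"
        using sQ T2 by (simp add: add_ac)
      have "sizes P = part (card A) + part (card B) + part (card X) + sizes ?R"
        using sP sizes_remove[of "P - {X}" A] sizes_remove[of "P - {X} - {A}" B] finP A B False
        by (simp add: add_ac)
      then show ?thesis
        using bound[OF A] bound[OF B] 2 T2 Q'
        by (intro transfer_two_distinct[of "card A" "card B" "card X"]) auto
    qed
  qed
qed

section \<open>Simulation by 1-deviations in the complete game\<close>

lemma uniform_game_complete: "finite V \<Longrightarrow> uniform_game V (\<lambda>_ _. 1)"
  using ereal_eq_1(1) by (auto simp: uniform_game_def coloring_game_def intro!: exI[of _ "1::int"])

lemma size_in_sizesE:
  assumes "finite P" "a \<in># sizes P"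
  obtains A where "A \<in> P" "card A = a"
proof -
  from assms obtain A where "A \<in> P" "a \<in># part (card A)"
    by (auto simp: sizes_def set_mset_sum)
  then show thesis using that by (auto simp: part_def split: if_splits)
qed

text \<open>With all weights 1 every partition is compatible, so sizes alone decide whether a move
  is a gain.\<close>

lemma transfer_realizable:
  assumes V: "finite V" and P: "partition_on V P" and step: "transfer_step (sizes P) N"
  obtains Q where "deviation V (\<lambda>_ _. 1) 1 P Q" "partition_on V Q" "sizes Q = N"
proof -
  from step obtain a b K where ab: "1 \<le> a" "a \<le> b" and sP: "sizes P = part a + part b + K"
    and N: "N = part (a - 1) + part (b + 1) + K"
    unfolding transfer_step_def by blast
  have finP: "finite P" using card_partition_le[OF V P] by simp
  have finC: "finite C" if "C \<in> P" for C
    using that P V by (auto simp: partition_on_def intro: finite_subset)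
  obtain A where A: "A \<in> P" "card A = a"
    using size_in_sizesE[OF finP, of a] sP ab by auto
  have sA: "sizes (P - {A}) = part b + K"
    using sizes_remove[OF finP A(1)] sP A(2) by simp
  \<comment> \<open>Searching only after \<open>A\<close> is removed yields a different group even
    when \<open>a = b\<close>.\<close>
  obtain B where B: "B \<in> P - {A}" "card B = b"
    using size_in_sizesE[of "P - {A}" b] finP sA ab by auto
  have sAB: "sizes (P - {A} - {B}) = K"
    using sizes_remove[of "P - {A}" B] finP B sA by simp
  obtain u where u: "u \<in> A" using A ab by fastforce
  have disj: "C \<inter> D = {}" if "C \<in> P" "D \<in> P" "C \<noteq> D" for C D
    using P that by (auto simp: partition_on_def disjoint_def)
  have uV: "{u} \<subseteq> V" using u A P by (auto simp: partition_on_def)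
  have uB: "u \<notin> B" using disj[of A B] A B u by auto
  define Q where "Q = move P {u} B"
  have pQ: "partition_on V Q"
    unfolding Q_def using P uV B by (intro partition_on_move) auto
  have YQ: "B \<union> {u} \<in> Q" by (auto simp: Q_def move_def)
  have cY: "card (B \<union> {u}) = b + 1" using B finC uB by auto
  have comp: "compatible (\<lambda>_ _. 1) R" for R :: "'a set set" by (simp add: compatible_def)
  have "utility (\<lambda>_ _. 1) P u < utility (\<lambda>_ _. 1) Q u"
    using utility_compatible[OF V P comp A(1) u] utility_compatible[OF V pQ comp YQ, of u] cY A ab
    by simp
  then have "deviation V (\<lambda>_ _. 1) 1 P Q"
    unfolding deviation_def using uV B Q_def
    by (intro exI[of _ "{u}"] exI[of _ B]) auto
  moreover have "sizes Q = N"
  proof -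
    have "(\<Sum>C\<in>P - {B}. part (card (C - {u}))) =
        part (card (A - {u})) + (\<Sum>C\<in>P - {B} - {A}. part (card (C - {u})))"
      using finP A B by (intro sum.remove) auto
    also have "(\<Sum>C\<in>P - {B} - {A}. part (card (C - {u}))) = sizes (P - {B} - {A})"
      using finP A u disj[of A] by (intro sum_part_Diff) auto
    also have "P - {B} - {A} = P - {A} - {B}" by auto
    finally show ?thesis
      using sizes_move[OF V P, of "{u}" B] cY sAB u A finC N
      by (simp add: Q_def add_ac)
  qed
  ultimately show thesis using that pQ by blast
qed

text \<open>The bound \<open>1 \<le> j\<close> ensures that the simulating sequence never falls
  behind the simulated one.\<close>

lemma transfers_realizable:
  assumes V: "finite V" and P: "partition_on V P" and steps: "transfer_step\<^sup>+\<^sup>+ (sizes P) N"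
  shows "\<exists>Q j. 1 \<le> j \<and> (deviation V (\<lambda>_ _. 1) 1 ^^ j) P Q \<and> partition_on V Q \<and> sizes Q = N"
  using steps
proof (induction rule: tranclp_induct)
  case (base N)
  then obtain Q where "deviation V (\<lambda>_ _. 1) 1 P Q" "partition_on V Q" "sizes Q = N"
    using transfer_realizable[OF V P] by blast
  then show ?case by (intro exI[of _ Q] exI[of _ 1]) (simp add: eq_OO)
next
  case (step N N')
  then obtain Q j where Q: "1 \<le> j" "(deviation V (\<lambda>_ _. 1) 1 ^^ j) P Q" "partition_on V Q"
    "sizes Q = N" by blast
  moreover obtain Q' where "deviation V (\<lambda>_ _. 1) 1 Q Q'" "partition_on V Q'" "sizes Q' = N'"
    using transfer_realizable[OF V Q(3)] step(2) Q(4) by blast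
  ultimately show ?case by (intro exI[of _ Q'] exI[of _ "Suc j"]) auto
qed

text \<open>Only the sizes are kept equal, not the partitions: in the exceptional cases two groups
  have exchanged roles. Equal sizes suffice because the next transfers depend on nothing
  else.\<close>

lemma simulation:
  assumes game: "uniform_game V w" and seq: "(deviation V w 2 ^^ m) (singletons V) P"
  shows "\<exists>Q j. m \<le> j \<and> (deviation V (\<lambda>_ _. 1) 1 ^^ j) (singletons V) Q \<and>
    partition_on V Q \<and> sizes Q = sizes P"
  using seq
proof (induction m arbitrary: P)
  case 0
  then have "P = singletons V" by simp
  moreover have "partition_on V P" using deviation_sequence[OF game order_refl 0] by simp
  ultimately show ?case by (intro exI[of _ P] exI[of _ 0]) simp
next
  case (Suc m)
  then obtain P' where P': "(deviation V w 2 ^^ m) (singletons V) P'" "deviation V w 2 P' P"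
    by auto
  have V: "finite V" using game by (simp add: uniform_game_def coloring_game_def)
  obtain Q j where Q: "m \<le> j" "(deviation V (\<lambda>_ _. 1) 1 ^^ j) (singletons V) Q"
    "partition_on V Q" "sizes Q = sizes P'"
    using Suc.IH[OF P'(1)] by blast
  have "transfer_step\<^sup>+\<^sup>+ (sizes Q) (sizes P)"
    using deviation_transfer[OF game _ _ P'(2)] deviation_sequence[OF game order_refl P'(1)] Q(4)
    by simp
  then obtain Q' i where Q': "1 \<le> i" "(deviation V (\<lambda>_ _. 1) 1 ^^ i) Q Q'" "partition_on V Q'"
    "sizes Q' = sizes P"
    using transfers_realizable[OF V Q(3)] by blast
  have "(deviation V (\<lambda>_ _. 1) 1 ^^ (j + i)) (singletons V) Q'"
    using Q(2) Q'(2) by (auto simp: relpowp_add)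
  moreover have "Suc m \<le> j + i" using Q(1) Q'(1) by simp
  ultimately show ?case using Q'(3,4) by blast
qed

section \<open>Comparison of the maximal lengths\<close>

lemma deviation_mono:
  assumes "deviation V w k P Q" "k \<le> l"
  shows "deviation V w l P Q"
  using assms unfolding deviation_def by (elim exE conjE, intro exI conjI) auto

lemma deviation_lengths_mono:
  assumes "k \<le> l"
  shows "deviation_lengths k n \<subseteq> deviation_lengths l n"
proof -
  have "(deviation V w k ^^ m) P Q \<Longrightarrow> (deviation V w l ^^ m) P Q"
    for V :: "nat set" and w m P Q
    by (erule relpowp_mono[rotated]) (rule deviation_mono[OF _ assms])
  then show ?thesis unfolding deviation_lengths_def by blast
qed

theorem theorem2:
  fixes n :: nat
  assumes "1 \<le> n"
  shows "L 2 n = L 1 n"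
proof (rule antisym)
  show "L 1 n \<le> L 2 n"
    unfolding L_def using deviation_lengths_nonempty[of 1 n] finite_deviation_lengths
    by (intro Max_mono deviation_lengths_mono) auto
  have "m \<le> Max (deviation_lengths 1 n)" if m: "m \<in> deviation_lengths 2 n" for m
  proof -
    from m obtain V :: "nat set" and w P where V: "uniform_game V w" "card V \<le> n"
      and seq: "(deviation V w 2 ^^ m) (singletons V) P"
      by (auto simp: deviation_lengths_def)
    then obtain Q j where j: "m \<le> j" "(deviation V (\<lambda>_ _. 1) 1 ^^ j) (singletons V) Q"
      using simulation by blast
    \<comment> \<open>The simulating game has the same player set, so its sequence counts for the
      same \<open>n\<close>.\<close>
    have "uniform_game V (\<lambda>_ _. 1)"
      using V(1) by (intro uniform_game_complete) (simp add: uniform_game_def coloring_game_def)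
    then have "j \<in> deviation_lengths 1 n"
      using j(2) V(2) unfolding deviation_lengths_def by blast
    then show ?thesis using j(1) Max_ge[OF finite_deviation_lengths] le_trans by blast
  qed
  then show "L 2 n \<le> L 1 n"
    unfolding L_def using deviation_lengths_nonempty[of 2 n] finite_deviation_lengths
    by (intro Max.boundedI) auto
qed

end
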